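(* Let $\gamma\ge 1$ and let $N\ge 0$ be an integer. For $n\ge N+1$ and any initial point $y_0\in\mathbb{R}^n$, there exists a $1/\gamma$-Lipschitz operator $\mathbb{T}\colon\mathbb{R}^n\to\mathbb{R}^n$ with a fixed point $y_\star\in\mathrm{Fix}\,\mathbb{T}$ such that \[ \|y_N-\mathbb{T}y_N\|^2\ge\left(1+\frac1\gamma\right)^2\left(\frac{1}{\sum_{k=0}^{N}\gamma^k}\right)^2\|y_0-y_\star\|^2 \] for any iterates $\{y_k\}_{k=0}^N$ (starting at the given $y_0$) satisfying \[ y_k\in y_0+\mathrm{span}\{y_0-\mathbb{T}y_0,\,y_1-\mathbb{T}y_1,\dots,y_{k-1}-\mathbb{T}y_{k-1}\},\qquad k=1,\dots,N. \]
   Context: $\mathbb{R}^n$ carries the standard Euclidean norm. $\mathrm{Fix}\,\mathbb{T}=\{y:\mathbb{T}y=y\}$. $\mathbb{T}$ is $1/\gamma$-Lipschitz if $\|\mathbb{T}x-\mathbb{T}y\|\le\frac1\gamma\|x-y\|$ for all $x,y$. *)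

theory Defs
  imports "HOL-Analysis.Analysis"
begin

definition Fix :: "('a \<Rightarrow> 'a) \<Rightarrow> 'a set" where
  "Fix T = {y. T y = y}"

text \<open>The iterates \<open>y\<^sub>0, \<dots>, y\<^sub>N\<close> are the values of a total sequence at
  the indices up to \<open>N\<close>; its values beyond \<open>N\<close> are unconstrained.\<close>

definition span_iterates ::
  "('a::real_vector \<Rightarrow> 'a) \<Rightarrow> 'a \<Rightarrow> nat \<Rightarrow> (nat \<Rightarrow> 'a) \<Rightarrow> bool" where
  "span_iterates T y0 N y \<longleftrightarrow>
     y 0 = y0 \<and>
     (\<forall>k\<in>{1..N}. y k \<in> (+) y0 ` span {y j - T (y j) | j. j < k})"

end

theory Submission
  imports Defs
begin

text \<open>Around \<open>y\<^sub>0\<close>, let \<open>T\<close> be \<open>1/\<gamma>\<close> times the signed cyclic shift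
  \<open>e\<^sub>0 \<mapsto> e\<^sub>1 \<mapsto> \<dots> \<mapsto> e\<^sub>N \<mapsto> -e\<^sub>0\<close> (composed with the orthogonal projection onto the span of
  the \<open>e\<^sub>k\<close>), plus the translation by \<open>e\<^sub>0\<close>. Each residual
  reveals at most one new coordinate, so \<open>y\<^sub>N - y\<^sub>0\<close> has no \<open>e\<^sub>N\<close>-component. On such points the
  residual has inner product \<open>-1\<close> with \<open>w = \<Sum>\<^sub>k \<gamma>\<^sup>k e\<^sub>k\<close>, so by Cauchy-Schwarz its squared norm is
  at least \<open>1 / \<Sum>\<^sub>k \<gamma>\<^sup>2\<^sup>k\<close>. The fixed point is \<open>y\<^sub>0 + c \<Sum>\<^sub>k \<gamma>\<^sup>N\<^sup>-\<^sup>k e\<^sub>k\<close> with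
  \<open>c = \<gamma> / (\<gamma>\<^sup>N\<^sup>+\<^sup>1 + 1)\<close>, and the two norms combine through
  \<open>(\<gamma> + 1) \<Sum>\<^sub>k \<gamma>\<^sup>2\<^sup>k = (\<gamma>\<^sup>N\<^sup>+\<^sup>1 + 1) \<Sum>\<^sub>k \<gamma>\<^sup>k\<close>.\<close>

text \<open>Times \<open>x - 1\<close>, both sides become
  \<open>(x ^ Suc N + 1) * (x ^ Suc N - 1)\<close>. Cancelling that factor would exclude
  \<open>x = 1\<close>, hence the induction.\<close>

lemma geometric_sum_squares:
  fixes x :: "'a::comm_ring_1"
  shows "(x + 1) * (\<Sum>k\<le>N. (x ^ k)\<^sup>2) = (x ^ Suc N + 1) * (\<Sum>k\<le>N. x ^ k)"
proof (induction N)
  case 0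
  then show ?case by simp
next
  case (Suc N)
  have geo: "(x - 1) * (\<Sum>k\<le>N. x ^ k) = x ^ Suc N - 1"
    using power_diff_1_eq[of x "Suc N"] by (simp add: lessThan_Suc_atMost)
  have "(x + 1) * (\<Sum>k\<le>Suc N. (x ^ k)\<^sup>2)
      = (x ^ Suc N + 1) * (\<Sum>k\<le>N. x ^ k) + (x + 1) * (x ^ Suc N)\<^sup>2"
    by (simp add: distrib_left Suc.IH)
  \<comment> \<open>Raising the exponent adds exactly the term subtracted at the end, to which
    \<open>geo\<close> applies.\<close>
  also have "\<dots> = (x ^ Suc (Suc N) + 1) * (\<Sum>k\<le>N. x ^ k) + (x + 1) * (x ^ Suc N)\<^sup>2
      - x ^ Suc N * ((x - 1) * (\<Sum>k\<le>N. x ^ k))"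
    by (simp add: algebra_simps)
  also have "\<dots> = (x ^ Suc (Suc N) + 1) * (\<Sum>k\<le>Suc N. x ^ k)"
    unfolding geo by (simp add: algebra_simps power2_eq_square)
  finally show ?case .
qed

locale orthonormal_sequence =
  fixes e :: "nat \<Rightarrow> 'a::real_inner" and N :: nat
  assumes orthonormal: "\<And>i j. i \<le> N \<Longrightarrow> j \<le> N \<Longrightarrow> e i \<bullet> e j = (if i = j then 1 else 0)"
begin

lemma inner_sum_left_basis:
  assumes "k \<le> N"
  shows "(\<Sum>i\<le>N. a i *\<^sub>R e i) \<bullet> e k = a k"
proof -
  have "(\<Sum>i\<le>N. a i *\<^sub>R e i) \<bullet> e k = (\<Sum>i\<le>N. if i = k then a i else 0)"
    unfolding inner_sum_left using assms by (intro sum.cong) (auto simp: orthonormal)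
  then show ?thesis using assms by simp
qed

lemma norm_sum_squared: "(norm (\<Sum>i\<le>N. a i *\<^sub>R e i))\<^sup>2 = (\<Sum>i\<le>N. (a i)\<^sup>2)"
proof -
  have "(norm (\<Sum>i\<le>N. a i *\<^sub>R e i))\<^sup>2
      = (\<Sum>k\<le>N. a k * ((\<Sum>i\<le>N. a i *\<^sub>R e i) \<bullet> e k))"
    by (simp only: power2_norm_eq_inner inner_sum_right[where A = "{..N}" and f = "\<lambda>k. a k *\<^sub>R e k"]
        inner_scaleR_right)
  then show ?thesis by (simp add: inner_sum_left_basis power2_eq_square)
qed

lemma bessel: "(\<Sum>k\<le>N. (z \<bullet> e k)\<^sup>2) \<le> (norm z)\<^sup>2"
proof -
  let ?p = "\<Sum>k\<le>N. (z \<bullet> e k) *\<^sub>R e k"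
  have "z \<bullet> ?p = (\<Sum>k\<le>N. (z \<bullet> e k)\<^sup>2)"
    by (simp add: inner_sum_right power2_eq_square)
  moreover have "0 \<le> (norm (z - ?p))\<^sup>2" by simp
  moreover have "(norm (z - ?p))\<^sup>2 = (norm z)\<^sup>2 - 2 * (z \<bullet> ?p) + (norm ?p)\<^sup>2"
    by (simp add: power2_norm_eq_inner inner_diff_left inner_diff_right inner_commute)
  ultimately show ?thesis by (simp add: norm_sum_squared)
qed

text \<open>The minus sign at the wrap-around puts \<open>\<gamma> ^ Suc N + 1\<close> in the
  denominator of the fixed point; a plus sign would give \<open>\<gamma> ^ Suc N - 1\<close>, which
  vanishes at \<open>\<gamma> = 1\<close>.\<close>

definition shift_basis :: "nat \<Rightarrow> 'a" where
  "shift_basis k = (if k = N then - e 0 else e (Suc k))"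

definition signed_shift :: "'a \<Rightarrow> 'a" where
  "signed_shift z = (\<Sum>k\<le>N. (z \<bullet> e k) *\<^sub>R shift_basis k)"

lemma orthonormal_shift_basis: "orthonormal_sequence shift_basis N"
  by unfold_locales (auto simp: shift_basis_def orthonormal)

text \<open>The coefficients of the projection of \<open>z\<close> are reused on another orthonormal
  family, so Bessel's inequality bounds the norm.\<close>

lemma norm_signed_shift_le: "norm (signed_shift z) \<le> norm z"
proof (rule power2_le_imp_le)
  show "(norm (signed_shift z))\<^sup>2 \<le> (norm z)\<^sup>2"
    unfolding signed_shift_def
      orthonormal_sequence.norm_sum_squared[OF orthonormal_shift_basis]
    by (rule bessel)
qed simp

lemma linear_signed_shift: "linear signed_shift"
  unfolding signed_shift_def
  by (intro linear_compose_sum ballI linearI)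
     (simp_all add: inner_add_left scaleR_add_left)

lemma signed_shift_basis:
  assumes "k \<le> N"
  shows "signed_shift (e k) = shift_basis k"
proof -
  have "signed_shift (e k) = (\<Sum>i\<le>N. if i = k then shift_basis i else 0)"
    unfolding signed_shift_def using assms by (intro sum.cong) (auto simp: orthonormal)
  then show ?thesis using assms by simp
qed

text \<open>Since \<open>j \<le> N\<close>, no generator is \<open>e N\<close>, so nothing wraps
  around and each index rises by one.\<close>

lemma signed_shift_span:
  assumes "z \<in> span {e i | i. i < j}" "j \<le> N"
  shows "signed_shift z \<in> span {e i | i. i < Suc j}"
  using assms(1)
proof (induction rule: span_induct)
  case base
  show ?case
    by (simp add: subspace_def linear_0[OF linear_signed_shift] linear_add[OF linear_signed_shift]
        linear_scale[OF linear_signed_shift] span_zero span_add span_scale)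
next
  case (step x)
  then obtain i where "x = e i" "i < j" by auto
  then have "signed_shift x = e (Suc i)"
    using assms(2) by (simp add: signed_shift_basis shift_basis_def)
  then show ?case using \<open>i < j\<close> by (auto intro!: span_base)
qed

definition worst_operator :: "real \<Rightarrow> 'a \<Rightarrow> 'a \<Rightarrow> 'a" where
  "worst_operator \<gamma> y0 x = y0 + e 0 + (1 / \<gamma>) *\<^sub>R signed_shift (x - y0)"

lemma lipschitz_worst_operator:
  assumes "\<gamma> > 0"
  shows "(1 / \<gamma>)-lipschitz_on UNIV (worst_operator \<gamma> y0)"
proof (rule lipschitz_onI)
  fix x y :: 'a
  have "worst_operator \<gamma> y0 x - worst_operator \<gamma> y0 y = (1 / \<gamma>) *\<^sub>R signed_shift (x - y)"
    using linear_diff[OF linear_signed_shift, of "x - y0" "y - y0"]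
    by (simp add: worst_operator_def flip: scaleR_diff_right)
  then show "dist (worst_operator \<gamma> y0 x) (worst_operator \<gamma> y0 y) \<le> 1 / \<gamma> * dist x y"
    using norm_signed_shift_le[of "x - y"] assms by (simp add: dist_norm divide_right_mono)
qed (use assms in simp)

lemma worst_operator_fixed_point:
  assumes "\<gamma> > 0"
  defines "z \<equiv> (\<gamma> / (\<gamma> ^ Suc N + 1)) *\<^sub>R (\<Sum>k\<le>N. \<gamma> ^ (N - k) *\<^sub>R e k)"
  shows "worst_operator \<gamma> y0 (y0 + z) = y0 + z"
    and "(norm z)\<^sup>2 = (\<gamma> / (\<gamma> ^ Suc N + 1))\<^sup>2 * (\<Sum>k\<le>N. (\<gamma> ^ k)\<^sup>2)"
proof -
  define c where "c = \<gamma> / (\<gamma> ^ Suc N + 1)"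
  have pos: "\<gamma> ^ Suc N + 1 > 0" using assms(1) by (simp add: add_pos_pos)
  have "c * (\<gamma> ^ Suc N + 1) = \<gamma>"
    using pos by (simp add: c_def)
  \<comment> \<open>The \<open>e 0\<close> coordinate of the fixed point equation: the translation
    contributes 1, and the last coordinate \<open>c\<close> of \<open>z\<close> wraps around to
    \<open>- c / \<gamma>\<close>.\<close>
  then have c: "c * \<gamma> ^ N = 1 - c / \<gamma>"
    using assms(1) by (simp add: field_simps)
  have shift: "signed_shift (\<Sum>k\<le>N. \<gamma> ^ (N - k) *\<^sub>R e k)
      = (\<Sum>k\<le>N. \<gamma> ^ (N - k) *\<^sub>R shift_basis k)"
    by (simp add: signed_shift_def inner_sum_left_basis)
  also have "\<dots> = (\<Sum>k<N. \<gamma> ^ (N - k) *\<^sub>R e (Suc k)) - e 0"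
    by (simp add: shift_basis_def flip: lessThan_Suc_atMost)
  also have "(\<Sum>k<N. \<gamma> ^ (N - k) *\<^sub>R e (Suc k))
      = \<gamma> *\<^sub>R (\<Sum>k<N. \<gamma> ^ (N - Suc k) *\<^sub>R e (Suc k))"
    unfolding scaleR_sum_right by (intro sum.cong) (auto simp flip: power_Suc simp: Suc_diff_Suc)
  finally have "(1 / \<gamma>) *\<^sub>R signed_shift z
      = c *\<^sub>R (\<Sum>k<N. \<gamma> ^ (N - Suc k) *\<^sub>R e (Suc k)) - (c / \<gamma>) *\<^sub>R e 0"
    using assms(1)
    by (simp add: z_def c_def[symmetric] linear_scale[OF linear_signed_shift] scaleR_diff_right
        del: power_Suc)
  \<comment> \<open>Splitting off index 0 here, and index \<open>N\<close> in the shifted sum,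
    leaves the same sum over \<open>e (Suc k)\<close>, so only the \<open>e 0\<close> coordinates
    remain to be compared.\<close>
  moreover have "z = (c * \<gamma> ^ N) *\<^sub>R e 0
      + c *\<^sub>R (\<Sum>k<N. \<gamma> ^ (N - Suc k) *\<^sub>R e (Suc k))"
    by (simp add: z_def c_def[symmetric] sum.atMost_shift scaleR_add_right del: power_Suc)
  ultimately show "worst_operator \<gamma> y0 (y0 + z) = y0 + z"
    by (simp add: worst_operator_def c scaleR_diff_left)
  have "(\<Sum>k\<le>N. (\<gamma> ^ (N - k))\<^sup>2) = (\<Sum>k\<le>N. (\<gamma> ^ k)\<^sup>2)"
    by (rule sum.nat_diff_reindex[where n = "Suc N", simplified lessThan_Suc_atMost, simplified])
  then show "(norm z)\<^sup>2 = (\<gamma> / (\<gamma> ^ Suc N + 1))\<^sup>2 * (\<Sum>k\<le>N. (\<gamma> ^ k)\<^sup>2)"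
    by (simp only: z_def norm_scaleR power_mult_distrib power2_abs norm_sum_squared)
qed

lemma span_iterates_worst_operator:
  assumes "span_iterates (worst_operator \<gamma> y0) y0 N y" "k \<le> N"
  shows "y k - y0 \<in> span {e i | i. i < k}"
  using assms(2)
proof (induction k rule: less_induct)
  case (less k)
  show ?case
  proof (cases "k = 0")
    case True
    then show ?thesis using assms(1) by (simp add: span_iterates_def)
  next
    case False
    have "y j - worst_operator \<gamma> y0 (y j) \<in> span {e i | i. i < k}" if "j < k" for j
    proof -
      have IH: "y j - y0 \<in> span {e i | i. i < j}" using less that by simp
      then have "signed_shift (y j - y0) \<in> span {e i | i. i < Suc j}"
        using signed_shift_span less.prems that by simp
      moreover have "span {e i | i. i < Suc j} \<subseteq> span {e i | i. i < k}"
        "span {e i | i. i < j} \<subseteq> span {e i | i. i < k}"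
        using that by (auto intro!: span_mono)
      \<comment> \<open>The translation vector lies in the span only for \<open>k > 0\<close>, hence
        the separate case \<open>k = 0\<close>.\<close>
      moreover have "e 0 \<in> span {e i | i. i < k}" using False by (auto intro!: span_base)
      ultimately have "(y j - y0) - e 0 - (1 / \<gamma>) *\<^sub>R signed_shift (y j - y0)
          \<in> span {e i | i. i < k}"
        using IH by (intro span_diff[OF span_diff] span_scale) auto
      then show ?thesis by (simp add: worst_operator_def algebra_simps)
    qed
    then have "span {y j - worst_operator \<gamma> y0 (y j) | j. j < k} \<subseteq> span {e i | i. i < k}"
      by (intro span_minimal) auto
    moreover have "y k \<in> (+) y0 ` span {y j - worst_operator \<gamma> y0 (y j) | j. j < k}"
      using assms(1) less.prems False by (simp add: span_iterates_def)
    ultimately show ?thesis by auto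
  qed
qed

lemma worst_operator_residual:
  assumes "\<gamma> > 0" "x - y0 \<in> span {e i | i. i < N}"
  shows "1 \<le> (\<Sum>k\<le>N. (\<gamma> ^ k)\<^sup>2) * (norm (x - worst_operator \<gamma> y0 x))\<^sup>2"
proof -
  define w where "w = (\<Sum>k\<le>N. \<gamma> ^ k *\<^sub>R e k)"
  \<comment> \<open>The coefficients of \<open>w\<close> grow by the factor \<gamma> per index,
    which offsets the contraction: \<open>w\<close> does not distinguish \<open>e i\<close> from its
    scaled shift \<open>e (Suc i)\<close> when \<open>i < N\<close>.\<close>
  have "w \<bullet> z = w \<bullet> ((1 / \<gamma>) *\<^sub>R signed_shift z)" if "z \<in> span {e i | i. i < N}" for z
    using that
  proof (induction rule: span_induct)
    case base
    show ?case
      by (simp add: subspace_def linear_0[OF linear_signed_shift]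
          linear_add[OF linear_signed_shift] linear_scale[OF linear_signed_shift]
          inner_add_right add_divide_distrib)
  next
    case (step z)
    then obtain i where "z = e i" "i < N" by auto
    then show ?case using assms(1)
      by (simp add: signed_shift_basis shift_basis_def w_def inner_sum_left_basis)
  qed
  from this[OF assms(2)] have "w \<bullet> (x - y0) = w \<bullet> ((1 / \<gamma>) *\<^sub>R signed_shift (x - y0))" .
  moreover have "w \<bullet> e 0 = 1" by (simp add: w_def inner_sum_left_basis)
  ultimately have "w \<bullet> (x - worst_operator \<gamma> y0 x) = - 1"
    by (simp add: worst_operator_def inner_diff_right inner_add_right)
  then have "1 \<le> norm w * norm (x - worst_operator \<gamma> y0 x)"
    using Cauchy_Schwarz_ineq2[of w "x - worst_operator \<gamma> y0 x"] by simp
  then have "1 \<le> (norm w * norm (x - worst_operator \<gamma> y0 x))\<^sup>2"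
    by (rule one_le_power)
  then show ?thesis by (simp add: power_mult_distrib w_def norm_sum_squared)
qed

end

theorem theorem4p1:
  fixes \<gamma> :: real and N :: nat and y0 :: "real ^ 'n"
  assumes "\<gamma> \<ge> 1"
    and "CARD('n) \<ge> N + 1"
  shows "\<exists>(T :: real ^ 'n \<Rightarrow> real ^ 'n) ystar.
           (1 / \<gamma>)-lipschitz_on UNIV T \<and> ystar \<in> Fix T \<and> ystar \<noteq> y0 \<and>
           (\<forall>y. span_iterates T y0 N y \<longrightarrow>
              (norm (y N - T (y N)))\<^sup>2
                \<ge> (1 + 1 / \<gamma>)\<^sup>2 * (1 / (\<Sum>k=0..N. \<gamma> ^ k))\<^sup>2 * (norm (y0 - ystar))\<^sup>2)"
proof -
  \<comment> \<open>The dimension bound allows \<open>N + 1\<close> distinct coordinates, whose unit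
    vectors serve as the orthonormal family.\<close>
  have "card {..N} \<le> card (UNIV :: 'n set)" using assms(2) by simp
  then obtain f :: "nat \<Rightarrow> 'n" where f: "inj_on f {..N}"
    using card_le_inj[of "{..N}" "UNIV :: 'n set"] by auto
  interpret orthonormal_sequence "\<lambda>k. axis (f k) 1 :: real ^ 'n" N
    by unfold_locales (use f in \<open>auto simp: inner_axis_axis inj_on_def\<close>)
  have \<gamma>: "\<gamma> > 0" using assms(1) by simp
  define T where "T = worst_operator \<gamma> y0"
  define c where "c = \<gamma> / (\<gamma> ^ Suc N + 1)"
  define z where "z = c *\<^sub>R (\<Sum>k\<le>N. \<gamma> ^ (N - k) *\<^sub>R (axis (f k) 1 :: real ^ 'n))"
  define S where "S = (\<Sum>k\<le>N. \<gamma> ^ k)"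
  define Q where "Q = (\<Sum>k\<le>N. (\<gamma> ^ k)\<^sup>2)"
  have "\<gamma> ^ Suc N + 1 > 0" using \<gamma> by (simp add: add_pos_pos)
  then have c: "c > 0" unfolding c_def using \<gamma> by (rule divide_pos_pos[rotated])
  have S: "S > 0" and Q: "Q > 0" unfolding S_def Q_def using \<gamma> by (auto intro!: sum_pos)
  have fix_z: "T (y0 + z) = y0 + z" and norm_z: "(norm z)\<^sup>2 = c\<^sup>2 * Q"
    using worst_operator_fixed_point[OF \<gamma>] by (simp_all add: T_def z_def c_def Q_def)
  have "(1 + 1 / \<gamma>) * c * Q = ((\<gamma> + 1) * Q) / (\<gamma> ^ Suc N + 1)"
    using \<gamma> by (simp add: c_def distrib_right del: power_Suc)
  also have "\<dots> = S"
    using geometric_sum_squares[of \<gamma> N] \<open>\<gamma> ^ Suc N + 1 > 0\<close>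
    by (simp add: S_def Q_def del: power_Suc)
  finally have S_eq: "(1 + 1 / \<gamma>)\<^sup>2 * c\<^sup>2 * Q\<^sup>2 = S\<^sup>2"
    by (metis power_mult_distrib)
  \<comment> \<open>The required lower bound collapses to \<open>1 / Q\<close>, exactly what
    Cauchy-Schwarz gives for the residual.\<close>
  have "(1 + 1 / \<gamma>)\<^sup>2 * (1 / S)\<^sup>2 * (norm z)\<^sup>2 = ((1 + 1 / \<gamma>)\<^sup>2 * c\<^sup>2 * Q\<^sup>2) / (S\<^sup>2 * Q)"
    unfolding norm_z using Q by (simp add: power_divide power2_eq_square)
  also have "\<dots> = 1 / Q" unfolding S_eq using S by simp
  finally have bound: "(1 + 1 / \<gamma>)\<^sup>2 * (1 / S)\<^sup>2 * (norm z)\<^sup>2 = 1 / Q" .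
  have "1 / Q \<le> (norm (y N - T (y N)))\<^sup>2" if "span_iterates T y0 N y" for y
    using worst_operator_residual[OF \<gamma> span_iterates_worst_operator[OF that[unfolded T_def] order_refl]] Q
    by (simp add: T_def Q_def[symmetric] field_simps)
  moreover have "z \<noteq> 0" using norm_z c Q by auto
  moreover have "(1 / \<gamma>)-lipschitz_on UNIV T"
    unfolding T_def using \<gamma> by (rule lipschitz_worst_operator)
  ultimately show ?thesis
    using fix_z bound
    by (intro exI[of _ T] exI[of _ "y0 + z"]) (simp add: Fix_def S_def atLeast0AtMost)
qed

end
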